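(* Let $F=\sum F_iX^i$ and $G=\sum G_iX^i$ be power series in $\mathcal{O}_{\mathbf{C}_p}[[X]]$ converging on the unit disc $D$ (either open, $D=\mathfrak{m}_{\mathbf{C}_p}$, or closed, $D=\mathcal{O}_{\mathbf{C}_p}$), with distinguished polynomials $P$ and $Q$ respectively. Let $n$ and $N$ be $\mathrm{wideg}(F)$ and $\mathrm{wideg}(G)$ in the open case, and $\mathrm{Lwideg}(F)$ and $\mathrm{Lwideg}(G)$ in the closed case. Then the $p$-adic valuation of the resultant of $F$ and $G$ on $D$ ($\mathrm{Res}^o(F,G)$ in the open case, $\mathrm{Res}^c(F,G)$ in the closed case) equals that of $\mathrm{Res}_x(F_nP,G_NQ)$. In particular, $$\mathrm{Res}_x(F_nP,G_NQ)=F_n^NG_N^n\prod_{\substack{1\le i\le n\\1\le j\le N}}(z_i-w_j)=\det\left(\mathrm{Syl}(F_nP,G_NQ,x)\right),$$ where $z_1,\dots,z_n$ and $w_1,\dots,w_N$ are the roots in $D$ of $F$ and $G$ (with multiplicity) and $\mathrm{Syl}(F_nP,G_NQ,x)$ is the Sylvester matrix of the two polynomials. Furthermore, the supremum $S$ of $\phi$ over the unit disc $D$ satisfies $$S\le v_p\left(\mathrm{Res}_x(F_nP,G_NQ)\right).$$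
   Context: $p$ is a prime, $\mathbf{C}_p$ the completion of $\overline{\mathbf{Q}}_p$, $v_p$ its valuation with $v_p(p)=1$; $\mathcal{O}_{\mathbf{C}_p}$ and $\mathfrak{m}_{\mathbf{C}_p}$ are the closed and open unit discs. For $F=\sum F_iX^i$, $\mathrm{wideg}(F)$ (resp. $\mathrm{Lwideg}(F)$) is the smallest (resp. largest) index $n$ with $v_p(F_n)=\min_i v_p(F_i)$; these are assumed finite in the open (resp. closed) case. Open case: the distinguished polynomial of $F$ is the monic polynomial $P$ of degree $n=\mathrm{wideg}(F)$, with non-leading coefficients in $\mathfrak{m}_{\mathbf{C}_p}$, such that $F=F_nPU$ with $U\in\mathcal{O}_{\mathbf{C}_p}[[X]]^\times$. Closed case: it is the monic polynomial $P$ of degree $n=\mathrm{Lwideg}(F)$ such that $F=F_nPh$, with $h\in\mathcal{O}_{\mathbf{C}_p}[[X]]^\times$ converging on $\mathcal{O}_{\mathbf{C}_p}$, whose constant coefficient is a unit, whose other coefficients are non-units, and which has no zero on the closed unit disc. Resultants (roots counted with multiplicity): $\mathrm{Res}^o(F,G)=F_n^N\prod_{z\in\mathfrak{m}_{\mathbf{C}_p},F(z)=0}G(z)$ with $n=\mathrm{wideg}(F)$, $N=\mathrm{wideg}(G)$; $\mathrm{Res}^c(F,G)=F_n^N\prod_{z\in\mathcal{O}_{\mathbf{C}_p},F(z)=0}G(z)$ with $n=\mathrm{Lwideg}(F)$, $N=\mathrm{Lwideg}(G)$. $\phi(x)=\min(v_p(F(x)),v_p(G(x)))$.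
   Formalization: The bound S ≤ v_p(Res_x(F_nP,G_NQ)) is stated except when n = N = 0 and F_0, G_0 are both non-units, where it always fails: for F = G = p the resultant is 1, of valuation 0, while S = 1. *)

theory Defs
  imports
    "HOL-Analysis.Elementary_Topology"
    "HOL-Library.Extended_Real"
    "HOL-Computational_Algebra.Polynomial_FPS"
    "Subresultants.Resultant_Prelim"
begin

section \<open>The field of p-adic complex numbers\<close>

text \<open>In a complete field containing the rationals, the closure of the rationals is their
  completion for the induced metric.\<close>

definition Qp :: "'a::{field_char_0, metric_space} set" where
  "Qp = closure \<rat>"

definition Qp_bar :: "'a::{field_char_0, metric_space} set" where
  "Qp_bar = {x. \<exists>f. f \<noteq> 0 \<and> (\<forall>i. coeff f i \<in> Qp) \<and> poly f x = 0}"

text \<open>The locale says that the type \<open>'a\<close>, with valuation \<open>v\<close>, is a completion of an algebraic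
  closure of the field of p-adic numbers; this determines it up to isometric isomorphism.
  The metric of the type class is tied to \<open>v\<close> by \<open>dist_eq\<close>, so that limits, closures and infinite
  sums in \<open>'a\<close> are those of the p-adic absolute value. By \<open>v_prime\<close>, \<open>v\<close> restricts to the p-adic
  valuation on the rationals, hence \<open>Qp\<close> is the field of p-adic numbers.\<close>

locale Cp =
  fixes p :: nat and v :: "'a::{field_char_0, complete_space} \<Rightarrow> ereal"
  assumes prime_p: "prime p"
    and v_eq_infinity_iff: "v x = \<infinity> \<longleftrightarrow> x = 0"
    and v_not_minus_infinity: "v x \<noteq> -\<infinity>"
    and v_mult: "v (x * y) = v x + v y"
    and v_add: "min (v x) (v y) \<le> v (x + y)"
    and v_prime: "v (of_nat p) = 1"
    and dist_eq: "dist x y = (if x = y then 0 else real p powr (- real_of_ereal (v (x - y))))"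
    and Qp_bar_alg_closed:
      "(\<And>i. coeff (f :: 'a poly) i \<in> Qp_bar) \<Longrightarrow> 0 < degree f \<Longrightarrow>
         \<exists>x\<in>Qp_bar. poly f x = 0"
    and Qp_bar_dense: "closure Qp_bar = (UNIV :: 'a set)"

definition closed_disc :: "('a \<Rightarrow> ereal) \<Rightarrow> 'a set" where
  "closed_disc v = {x. 0 \<le> v x}"

definition open_disc :: "('a \<Rightarrow> ereal) \<Rightarrow> 'a set" where
  "open_disc v = {x. 0 < v x}"


section \<open>Power series\<close>

definition integral_fps :: "('a::zero \<Rightarrow> ereal) \<Rightarrow> 'a fps \<Rightarrow> bool" where
  "integral_fps v F \<longleftrightarrow> (\<forall>i. fps_nth F i \<in> closed_disc v)"

definition integral_unit_fps :: "('a::comm_ring_1 \<Rightarrow> ereal) \<Rightarrow> 'a fps \<Rightarrow> bool" where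
  "integral_unit_fps v F \<longleftrightarrow> integral_fps v F \<and> (\<exists>H. integral_fps v H \<and> F * H = 1)"

definition converges_on :: "'a::{field, metric_space} set \<Rightarrow> 'a fps \<Rightarrow> bool" where
  "converges_on D F \<longleftrightarrow> (\<forall>x\<in>D. summable (\<lambda>i. fps_nth F i * x ^ i))"

text \<open>The library function \<open>eval_fps\<close> is only available over real normed algebras.\<close>

definition ps_eval :: "'a::{field, metric_space} fps \<Rightarrow> 'a \<Rightarrow> 'a" where
  "ps_eval F x = (\<Sum>i. fps_nth F i * x ^ i)"

definition min_indices :: "('a::zero \<Rightarrow> ereal) \<Rightarrow> 'a fps \<Rightarrow> nat set" where
  "min_indices v F = {n. \<forall>i. v (fps_nth F n) \<le> v (fps_nth F i)}"

definition wideg :: "('a::zero \<Rightarrow> ereal) \<Rightarrow> 'a fps \<Rightarrow> nat" where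
  "wideg v F = (LEAST n. n \<in> min_indices v F)"

definition Lwideg :: "('a::zero \<Rightarrow> ereal) \<Rightarrow> 'a fps \<Rightarrow> nat" where
  "Lwideg v F = Max (min_indices v F)"

text \<open>The zero series, all of whose coefficients have valuation \<open>\<infinity>\<close>, counts as having infinite
  degree; for \<open>Lwideg\<close> this is automatic, since every index is then minimal.\<close>

definition wideg_finite :: "('a::zero \<Rightarrow> ereal) \<Rightarrow> 'a fps \<Rightarrow> bool" where
  "wideg_finite v F \<longleftrightarrow> F \<noteq> 0 \<and> min_indices v F \<noteq> {}"

definition Lwideg_finite :: "('a::zero \<Rightarrow> ereal) \<Rightarrow> 'a fps \<Rightarrow> bool" where
  "Lwideg_finite v F \<longleftrightarrow> min_indices v F \<noteq> {} \<and> finite (min_indices v F)"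


section \<open>Distinguished polynomials\<close>

definition distinguished_open :: "('a::field \<Rightarrow> ereal) \<Rightarrow> 'a fps \<Rightarrow> 'a poly \<Rightarrow> bool" where
  "distinguished_open v F P \<longleftrightarrow>
     lead_coeff P = 1 \<and> degree P = wideg v F \<and>
     (\<forall>i<degree P. coeff P i \<in> open_disc v) \<and>
     (\<exists>U. integral_unit_fps v U \<and>
          F = fps_const (fps_nth F (wideg v F)) * fps_of_poly P * U)"

definition distinguished_closed ::
    "('a::{field, metric_space} \<Rightarrow> ereal) \<Rightarrow> 'a fps \<Rightarrow> 'a poly \<Rightarrow> bool" where
  "distinguished_closed v F P \<longleftrightarrow>
     lead_coeff P = 1 \<and> degree P = Lwideg v F \<and>
     (\<exists>h. integral_unit_fps v h \<and> converges_on (closed_disc v) h \<and>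
          v (fps_nth h 0) = 0 \<and> (\<forall>i>0. 0 < v (fps_nth h i)) \<and>
          (\<forall>x\<in>closed_disc v. ps_eval h x \<noteq> 0) \<and>
          F = fps_const (fps_nth F (Lwideg v F)) * fps_of_poly P * h)"


section \<open>Roots and resultants\<close>

text \<open>The analogue, in the ring of power series converging on \<open>D\<close>, of the multiplicity \<open>order\<close> of a
  root of a polynomial. Convergence of the cofactor \<open>H\<close> is essential: for \<open>z \<noteq> 0\<close> the series
  \<open>X - z\<close> is invertible in the ring of all formal power series.\<close>

definition root_mult :: "'a::{field, metric_space} set \<Rightarrow> 'a fps \<Rightarrow> 'a \<Rightarrow> nat" where
  "root_mult D F z =
     (LEAST k. \<not> (\<exists>H. converges_on D H \<and> F = (fps_X - fps_const z) ^ Suc k * H))"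

definition ps_roots :: "'a::{field, metric_space} set \<Rightarrow> 'a fps \<Rightarrow> 'a set" where
  "ps_roots D F = {z \<in> D. ps_eval F z = 0}"

text \<open>\<open>z 1, \<dots>, z n\<close> are the roots of \<open>F\<close> in \<open>D\<close>, each listed as often as its multiplicity.\<close>

definition enumerates_roots ::
    "'a::{field, metric_space} set \<Rightarrow> 'a fps \<Rightarrow> nat \<Rightarrow> (nat \<Rightarrow> 'a) \<Rightarrow> bool" where
  "enumerates_roots D F n z \<longleftrightarrow>
     z ` {1..n} = ps_roots D F \<and>
     (\<forall>x\<in>ps_roots D F. card {i\<in>{1..n}. z i = x} = root_mult D F x)"

definition Res_open :: "('a::{field, metric_space} \<Rightarrow> ereal) \<Rightarrow> 'a fps \<Rightarrow> 'a fps \<Rightarrow> 'a" where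
  "Res_open v F G =
     fps_nth F (wideg v F) ^ wideg v G *
     (\<Prod>z\<in>ps_roots (open_disc v) F. ps_eval G z ^ root_mult (open_disc v) F z)"

definition Res_closed :: "('a::{field, metric_space} \<Rightarrow> ereal) \<Rightarrow> 'a fps \<Rightarrow> 'a fps \<Rightarrow> 'a" where
  "Res_closed v F G =
     fps_nth F (Lwideg v F) ^ Lwideg v G *
     (\<Prod>z\<in>ps_roots (closed_disc v) F. ps_eval G z ^ root_mult (closed_disc v) F z)"

end

theory Submission
  imports
    Defs
    "HOL-Analysis.Elementary_Metric_Spaces"
    "Subresultants.Subresultant"
begin

text \<open>
  In both cases the distinguished polynomial gives \<open>F = c P h\<close> on the disc \<open>D\<close>, where \<open>c = F\<^sub>n\<close>
  satisfies \<open>0 < \<bar>c\<bar> \<le> 1\<close>, all roots of the monic polynomial \<open>P\<close> lie in \<open>D\<close>, and \<open>\<bar>h(x)\<bar> = 1\<close> for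
  every \<open>x\<close> in \<open>D\<close>. The last point holds because the terms of \<open>h(x)\<close> after the constant one have absolute
  value below 1 (in the open case thanks to \<open>x\<close>, in the closed case thanks to the coefficients), while
  the constant one is a unit. The open and closed cases differ in nothing else, so the rest of the
  proof knows only these properties (locale \<open>weierstrass_factorization\<close>). On \<open>D\<close> the series \<open>F\<close> then has the
  same roots with the same multiplicities as \<open>P\<close>, and \<open>\<bar>F(x)\<bar> = \<bar>c P(x)\<bar>\<close>; the resultant on \<open>D\<close>, a
  product of values of \<open>G\<close> at the roots of \<open>F\<close>, thus has the absolute value of the product
  \<open>c\<^sup>N d\<^sup>n \<Prod>\<^sub>i \<Prod>\<^sub>j (z\<^sub>i - w\<^sub>j)\<close>, where \<open>G = d Q k\<close> is the factorization of \<open>G\<close>.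

  That this product is the resultant of \<open>c P\<close> and \<open>d Q\<close> needs two facts. One is that the field is
  algebraically closed (\<open>alg_closed\<close>): only polynomials over the dense subset \<open>Qp_bar\<close> have roots by
  assumption, but they yield approximate roots of any polynomial \<open>f\<close>, and these can be corrected to a Cauchy
  sequence because, by induction on the degree, every polynomial \<open>f - f(b)\<close> splits. The other is the
  product formula for the Sylvester determinant (\<open>resultant_eq_prod_proots\<close>), which follows from the
  Euclidean algorithm since both sides change in the same way under division with remainder.

  For the supremum, \<open>\<bar>z\<^sub>i - w\<^sub>j\<bar> \<le> max \<bar>x - z\<^sub>i\<bar> \<bar>x - w\<^sub>j\<bar>\<close>. Choose the root nearest to \<open>x\<close> among all \<open>z\<^sub>i\<close> and
  \<open>w\<^sub>j\<close>. If it is \<open>z\<^sub>l\<close>, then \<open>\<bar>z\<^sub>l - w\<^sub>j\<bar> \<le> \<bar>x - w\<^sub>j\<bar>\<close> for all \<open>j\<close>, all other factors are at most 1, and the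
  resultant is bounded by \<open>\<bar>G(x)\<bar>\<close>; in the other case it is bounded by \<open>\<bar>F(x)\<bar>\<close> (\<open>resultant_bound\<close>).
\<close>

section \<open>The absolute value\<close>

context Cp
begin

text \<open>Estimates are carried out with real absolute values instead of extended real valuations, so that
  products and powers are those of an ordered field; \<open>absv_le_iff\<close> translates back, reversing the order.\<close>

definition absv :: "'a \<Rightarrow> real" where
  "absv x = dist x 0"

lemma p_gt_1: "1 < real p"
  using prime_gt_1_nat[OF prime_p] by simp

lemma absv_nonneg [simp]: "0 \<le> absv x"
  and absv_0 [simp]: "absv 0 = 0"
  and absv_eq_0_iff [simp]: "absv x = 0 \<longleftrightarrow> x = 0"
  by (auto simp: absv_def)

lemma absv_pos_iff [simp]: "0 < absv x \<longleftrightarrow> x \<noteq> 0"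
  by (auto simp: absv_def)

lemma absv_eq: "x \<noteq> 0 \<Longrightarrow> absv x = real p powr (- real_of_ereal (v x))"
  by (simp add: absv_def dist_eq)

lemma dist_absv: "dist x y = absv (x - y)"
  by (simp add: absv_def dist_eq)

lemma v_finite: "x \<noteq> 0 \<Longrightarrow> \<exists>r. v x = ereal r"
  using v_eq_infinity_iff[of x] v_not_minus_infinity[of x] by (cases "v x") auto

lemma v_0: "v 0 = \<infinity>"
  by (simp add: v_eq_infinity_iff)

lemma absv_le_iff: "absv x \<le> absv y \<longleftrightarrow> v y \<le> v x"
proof (cases "x = 0 \<or> y = 0")
  case True
  have "absv x \<le> 0 \<longleftrightarrow> x = 0"
    using absv_nonneg[of x] absv_eq_0_iff[of x] by linarith
  with True show ?thesis
    using v_finite[of x] by (auto simp: v_0)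
next
  case False
  then obtain r s where "v x = ereal r" "v y = ereal s"
    using v_finite by meson
  with False show ?thesis
    using p_gt_1 by (simp add: absv_eq)
qed

lemma v_1: "v 1 = 0"
proof -
  obtain r where "v 1 = ereal r"
    using v_finite[of 1] by auto
  with v_mult[of 1 1] show ?thesis
    by (simp add: zero_ereal_def)
qed

lemma absv_1 [simp]: "absv 1 = 1"
  using absv_eq[of 1] p_gt_1 by (simp add: v_1)

lemma absv_le_1_iff: "absv x \<le> 1 \<longleftrightarrow> 0 \<le> v x"
  using absv_le_iff[of x 1] by (simp add: v_1)

lemma absv_less_1_iff: "absv x < 1 \<longleftrightarrow> 0 < v x"
  using absv_le_iff[of 1 x] by (simp add: v_1 flip: not_le)

lemma absv_eq_iff: "absv x = absv y \<longleftrightarrow> v x = v y"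
  using absv_le_iff[of x y] absv_le_iff[of y x] by (metis order_antisym order_refl)

lemma closed_disc_iff: "x \<in> closed_disc v \<longleftrightarrow> absv x \<le> 1"
  by (simp add: closed_disc_def absv_le_1_iff)

lemma open_disc_iff: "x \<in> open_disc v \<longleftrightarrow> absv x < 1"
  by (simp add: open_disc_def absv_less_1_iff)

lemma absv_mult: "absv (x * y) = absv x * absv y"
proof (cases "x = 0 \<or> y = 0")
  case False
  then obtain r s where "v x = ereal r" "v y = ereal s"
    using v_finite by meson
  with False show ?thesis
    by (simp add: absv_eq v_mult powr_add[symmetric])
qed auto

lemma absv_add: "absv (x + y) \<le> max (absv x) (absv y)"
proof -
  consider "v x \<le> v (x + y)" | "v y \<le> v (x + y)"
    using v_add[of x y] by (auto simp: min_def split: if_splits)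
  then show ?thesis
    by cases (simp_all add: absv_le_iff[symmetric] le_max_iff_disj)
qed

lemma absv_minus [simp]: "absv (- x) = absv x"
proof -
  have "absv (- 1) * absv (- 1) = 1"
    by (simp flip: absv_mult)
  then have "absv (- 1) = 1"
    using absv_nonneg[of "- 1"] power2_eq_1_iff[of "absv (- 1)"] unfolding power2_eq_square by linarith
  then show ?thesis
    using absv_mult[of "-1" x] by simp
qed

lemma absv_diff_commute: "absv (x - y) = absv (y - x)"
  using absv_minus[of "x - y"] by simp

lemma absv_diff: "absv (x - y) \<le> max (absv x) (absv y)"
  using absv_add[of x "- y"] by simp

lemma absv_power: "absv (x ^ n) = absv x ^ n"
  by (induction n) (simp_all add: absv_mult)

lemma absv_prod: "absv (\<Prod>i\<in>A. f i) = (\<Prod>i\<in>A. absv (f i))"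
  by (induction A rule: infinite_finite_induct) (simp_all add: absv_mult)

lemma absv_prod_mset: "absv (\<Prod>i\<in>#A. f i) = (\<Prod>i\<in>#A. absv (f i))"
  by (induction A) (simp_all add: absv_mult)

lemma absv_sum_le:
  assumes "\<And>i. i \<in> A \<Longrightarrow> absv (f i) \<le> b" "0 \<le> b"
  shows "absv (\<Sum>i\<in>A. f i) \<le> b"
  using assms
proof (induction A rule: infinite_finite_induct)
  case (insert a A)
  then show ?case
    using absv_add[of "f a" "\<Sum>i\<in>A. f i"] by fastforce
qed auto

lemma absv_sum_less:
  assumes "\<And>i. i \<in> A \<Longrightarrow> absv (f i) < b" "0 < b"
  shows "absv (\<Sum>i\<in>A. f i) < b"
  using assms
proof (induction A rule: infinite_finite_induct)
  case (insert a A)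
  then show ?case
    using absv_add[of "f a" "\<Sum>i\<in>A. f i"] by fastforce
qed auto

text \<open>The isosceles triangle principle: in an ultrametric triangle the two longest sides are equal.\<close>

lemma absv_eq_if_close:
  assumes "absv (x - y) < absv y"
  shows "absv x = absv y"
proof -
  have "absv x \<le> absv y"
    using absv_add[of "x - y" y] assms by simp
  moreover have "absv y \<le> absv x"
    using absv_diff[of x "x - y"] assms by (simp add: le_max_iff_disj)
  ultimately show ?thesis
    by simp
qed


section \<open>Limits and power series\<close>

text \<open>The field is a metric space, but not an instance of the type classes of topological rings; continuity of
  the operations comes from the properties of the absolute value.\<close>

lemma tendsto_absv_iff: "f \<longlonglongrightarrow> l \<longleftrightarrow> (\<lambda>k. absv (f k - l)) \<longlonglongrightarrow> 0"
  by (subst tendsto_dist_iff) (simp add: dist_absv)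

lemma tendsto_add_Cp:
  fixes a b :: 'a
  assumes "f \<longlonglongrightarrow> a" "g \<longlonglongrightarrow> b"
  shows "(\<lambda>k. f k + g k) \<longlonglongrightarrow> a + b"
  unfolding tendsto_absv_iff
proof (rule tendsto_sandwich)
  show "\<forall>\<^sub>F k in sequentially. 0 \<le> absv (f k + g k - (a + b))"
    by simp
  show "\<forall>\<^sub>F k in sequentially. absv (f k + g k - (a + b)) \<le> max (absv (f k - a)) (absv (g k - b))"
    using absv_add by (intro always_eventually allI) (simp add: add_diff_add)
  show "(\<lambda>k. max (absv (f k - a)) (absv (g k - b))) \<longlonglongrightarrow> 0"
    using tendsto_max[OF assms[unfolded tendsto_absv_iff]] by simp
  show "(\<lambda>k. 0) \<longlonglongrightarrow> (0 :: real)"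
    by (rule tendsto_const)
qed

lemma tendsto_mult_Cp:
  fixes a b :: 'a
  assumes "f \<longlonglongrightarrow> a" "g \<longlonglongrightarrow> b"
  shows "(\<lambda>k. f k * g k) \<longlonglongrightarrow> a * b"
proof -
  note lims = assms[unfolded tendsto_absv_iff]
  have null: "(\<lambda>k. h k) \<longlonglongrightarrow> 0" if "(\<lambda>k. absv (h k)) \<longlonglongrightarrow> 0" for h :: "nat \<Rightarrow> 'a"
    using that by (subst tendsto_absv_iff) simp
  have "(\<lambda>k. (f k - a) * (g k - b)) \<longlonglongrightarrow> 0"
    using tendsto_mult[OF lims] by (intro null) (simp add: absv_mult)
  moreover have "(\<lambda>k. a * (g k - b)) \<longlonglongrightarrow> 0"
    using tendsto_mult[OF tendsto_const[of "absv a"] lims(2)] by (intro null) (simp add: absv_mult)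
  moreover have "(\<lambda>k. (f k - a) * b) \<longlonglongrightarrow> 0"
    using tendsto_mult[OF lims(1) tendsto_const[of "absv b"]] by (intro null) (simp add: absv_mult)
  ultimately have "(\<lambda>k. (f k - a) * (g k - b) + (a * (g k - b) + (f k - a) * b) + a * b)
      \<longlonglongrightarrow> 0 + (0 + 0) + a * b"
    by (intro tendsto_add_Cp tendsto_const)
  then show ?thesis
    by (simp add: algebra_simps)
qed

lemma tendsto_poly_Cp: "f \<longlonglongrightarrow> a \<Longrightarrow> (\<lambda>k. poly q (f k)) \<longlonglongrightarrow> poly q a"
  for a :: 'a
  by (induction q) (auto intro!: tendsto_add_Cp tendsto_mult_Cp)

text \<open>By the ultrametric inequality, the distance between two members of the sequence is at most the
  largest step between them.\<close>

lemma convergent_if_geometric_steps: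
  assumes r: "0 \<le> r" "r < 1" and step: "\<And>k. absv (y (Suc k) - y k) \<le> r ^ k"
  shows "convergent y"
proof -
  have le: "absv (y (k + m) - y k) \<le> r ^ k" for k m
  proof (induction m)
    case (Suc m)
    have "absv (y (Suc (k + m)) - y (k + m)) \<le> r ^ k"
      using step[of "k + m"] r by (smt (verit) power_decreasing le_add1)
    then show ?case
      using Suc absv_add[of "y (Suc (k + m)) - y (k + m)" "y (k + m) - y k"] by simp
  qed (use r in simp)
  have "Cauchy y"
  proof (rule metric_CauchyI)
    fix e :: real assume "0 < e"
    then obtain M where M: "r ^ M < e"
      using r real_arch_pow_inv by blast
    show "\<exists>M. \<forall>m\<ge>M. \<forall>k\<ge>M. dist (y m) (y k) < e"
    proof (intro exI allI impI)
      fix m k assume "M \<le> m" "M \<le> k"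
      then have "absv (y m - y M) \<le> r ^ M" "absv (y k - y M) \<le> r ^ M"
        using le[of M "m - M"] le[of M "k - M"] by simp_all
      then show "dist (y m) (y k) < e"
        using M absv_diff[of "y m - y M" "y k - y M"] by (simp add: dist_absv)
    qed
  qed
  then show ?thesis
    by (rule Cauchy_convergent)
qed

lemma sums_add_Cp: "f sums a \<Longrightarrow> g sums b \<Longrightarrow> (\<lambda>i. f i + g i) sums (a + b)"
  for a b :: 'a
  unfolding sums_def by (simp add: sum.distrib tendsto_add_Cp)

lemma sums_cmult_Cp: "f sums a \<Longrightarrow> (\<lambda>i. c * f i) sums (c * a)"
  for a c :: 'a
  unfolding sums_def by (simp add: sum_distrib_left[symmetric] tendsto_mult_Cp tendsto_const)

text \<open>Evaluation is multiplicative as soon as one factor is a polynomial, which is all that is needed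
  for \<open>F = c P h\<close>: by Horner's rule it reduces to multiplication by \<open>X\<close>, a shift of the partial sums.\<close>

lemma sums_poly_mult:
  fixes x s :: 'a
  assumes "(\<lambda>i. fps_nth H i * x ^ i) sums s"
  shows "(\<lambda>i. fps_nth (fps_of_poly q * H) i * x ^ i) sums (poly q x * s)"
proof (induction q)
  case 0
  show ?case by (simp add: sums_def)
next
  case (pCons a q)
  let ?u = "\<lambda>i. fps_nth (fps_of_poly q * H) i * x ^ i"
  let ?w = "\<lambda>i. fps_nth (fps_X * (fps_of_poly q * H)) i * x ^ i"
  have "?w 0 = 0" "\<And>i. ?w (Suc i) = x * ?u i"
    by (simp_all add: mult.left_commute)
  then have "(\<lambda>k. sum ?w {..<Suc k}) = (\<lambda>k. x * sum ?u {..<k})"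
    unfolding sum.lessThan_Suc_shift by (simp only: sum_distrib_left add_0_left)
  moreover have "(\<lambda>k. x * sum ?u {..<k}) \<longlonglongrightarrow> x * (poly q x * s)"
    using pCons.IH by (intro tendsto_mult_Cp tendsto_const) (simp add: sums_def)
  ultimately have "(\<lambda>k. sum ?w {..<Suc k}) \<longlonglongrightarrow> x * (poly q x * s)"
    by simp
  then have "?w sums (x * (poly q x * s))"
    unfolding sums_def by (rule LIMSEQ_imp_Suc)
  from sums_add_Cp[OF sums_cmult_Cp[OF assms, of a] this] show ?case
    by (simp add: fps_of_poly_pCons algebra_simps)
qed

lemma
  fixes x :: 'a
  assumes "converges_on D H" "x \<in> D"
  shows ps_eval_poly_mult: "ps_eval (fps_of_poly q * H) x = poly q x * ps_eval H x"
    and summable_poly_mult: "summable (\<lambda>i. fps_nth (fps_of_poly q * H) i * x ^ i)"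
proof -
  have "(\<lambda>i. fps_nth H i * x ^ i) sums ps_eval H x"
    using assms unfolding converges_on_def ps_eval_def by (blast intro: summable_sums)
  from sums_poly_mult[OF this, of q]
  show "ps_eval (fps_of_poly q * H) x = poly q x * ps_eval H x"
    and "summable (\<lambda>i. fps_nth (fps_of_poly q * H) i * x ^ i)"
    unfolding ps_eval_def by (auto simp: sums_iff)
qed

lemma converges_on_poly_mult: "converges_on D H \<Longrightarrow> converges_on D (fps_of_poly q * H)"
  for D :: "'a set"
  using summable_poly_mult by (auto simp: converges_on_def)

lemma integral_fps_converges_on_open_disc:
  assumes "integral_fps v H"
  shows "converges_on (open_disc v) H"
  unfolding converges_on_def
proof
  fix x assume "x \<in> open_disc v"
  then have x: "absv x < 1"
    by (simp add: open_disc_iff)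
  have "convergent (\<lambda>k. \<Sum>i<k. fps_nth H i * x ^ i)"
  proof (rule convergent_if_geometric_steps)
    fix k
    have "absv (fps_nth H k) * absv x ^ k \<le> 1 * absv x ^ k"
      using assms by (intro mult_right_mono) (simp_all add: integral_fps_def closed_disc_iff)
    then show "absv ((\<Sum>i<Suc k. fps_nth H i * x ^ i) - (\<Sum>i<k. fps_nth H i * x ^ i)) \<le> absv x ^ k"
      by (simp add: absv_mult absv_power)
  qed (use x in auto)
  then show "summable (\<lambda>i. fps_nth H i * x ^ i)"
    by (auto simp: summable_def sums_def convergent_def)
qed

text \<open>By the isosceles triangle principle all nonempty partial sums have absolute value 1, and the
  limit has the absolute value of any partial sum close enough to it.\<close>

lemma absv_suminf_eq_1:
  fixes f :: "nat \<Rightarrow> 'a"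
  assumes "summable f" "absv (f 0) = 1" "\<And>i. 0 < i \<Longrightarrow> absv (f i) < 1"
  shows "absv (suminf f) = 1"
proof -
  have partial: "absv (sum f {..<Suc k}) = 1" for k
  proof -
    have "sum f {..<Suc k} - f 0 = (\<Sum>i<k. f (Suc i))"
      unfolding sum.lessThan_Suc_shift by simp
    also have "absv \<dots> < absv (f 0)"
      using assms by (intro absv_sum_less) auto
    finally show ?thesis
      using absv_eq_if_close assms(2) by metis
  qed
  have "(\<lambda>k. sum f {..<k}) \<longlonglongrightarrow> suminf f"
    using summable_sums[OF assms(1)] by (simp add: sums_def)
  from metric_LIMSEQ_D[OF this, of 1]
  obtain M where M: "\<And>k. M \<le> k \<Longrightarrow> dist (sum f {..<k}) (suminf f) < 1"
    by auto
  have "absv (suminf f - sum f {..<Suc M}) < absv (sum f {..<Suc M})"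
    using M[of "Suc M"] partial[of M] by (simp add: dist_absv absv_diff_commute)
  from absv_eq_if_close[OF this] partial[of M] show ?thesis
    by simp
qed

end


section \<open>Algebraic closedness\<close>

lemma proots_linear_factor_mult:
  fixes g :: "'b::field poly"
  assumes "g \<noteq> 0"
  shows "proots ([:-x, 1:] * g) = add_mset x (proots g)"
proof -
  have "proots ([:-x, 1:] * g) = proots [:-x, 1:] + proots g"
    using assms by (intro proots_mult) auto
  then show ?thesis
    unfolding proots_linear_factor by simp
qed

text \<open>The hypothesis on polynomials of lower degree makes this usable inside the induction that proves
  algebraic closedness.\<close>

lemma size_proots_if_root:
  fixes f :: "'b::field poly"
  assumes lower: "\<And>g::'b poly. 0 < degree g \<Longrightarrow> degree g < degree f \<Longrightarrow> \<exists>x. poly g x = 0"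
    and "f \<noteq> 0" and root: "0 < degree f \<Longrightarrow> \<exists>x. poly f x = 0"
  shows "size (proots f) = degree f"
  using assms
proof (induction "degree f" arbitrary: f rule: less_induct)
  case less
  show ?case
  proof (cases "degree f = 0")
    case True
    then show ?thesis
      using size_proots_le[of f] by simp
  next
    case False
    then obtain x where "poly f x = 0"
      using less.prems(3) by auto
    then obtain g where f: "f = [:-x, 1:] * g"
      by (auto simp: poly_eq_0_iff_dvd dvd_def)
    with less.prems(2) have g: "g \<noteq> 0" "degree f = Suc (degree g)"
      by (auto simp: degree_mult_eq simp del: mult_pCons_left)
    have "size (proots g) = degree g"
      using less.prems(1) g by (intro less.hyps) auto
    moreover have "proots f = add_mset x (proots g)"
      unfolding f using g(1) by (rule proots_linear_factor_mult)
    ultimately show ?thesis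
      using g(2) by simp
  qed
qed

lemma poly_eq_prod_proots:
  fixes f :: "'b::field poly"
  assumes "size (proots f) = degree f"
  shows "f = Polynomial.smult (lead_coeff f) (\<Prod>x\<in>#proots f. [:-x, 1:])"
  using assms
proof (induction "degree f" arbitrary: f)
  case 0
  then obtain a where "f = [:a:]"
    by (metis degree_eq_zeroE)
  then show ?case
    by simp
next
  case (Suc n)
  then have "f \<noteq> 0" "proots f \<noteq> {#}"
    by auto
  then obtain x where "x \<in># proots f"
    by blast
  with \<open>f \<noteq> 0\<close> have "poly f x = 0"
    by simp
  then obtain g where f: "f = [:-x, 1:] * g"
    by (auto simp: poly_eq_0_iff_dvd dvd_def)
  with \<open>f \<noteq> 0\<close> have g: "g \<noteq> 0" "degree f = Suc (degree g)"
    by (auto simp: degree_mult_eq simp del: mult_pCons_left)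
  have roots: "proots f = add_mset x (proots g)"
    unfolding f using g by (intro proots_linear_factor_mult)
  have lead: "lead_coeff f = lead_coeff g"
    unfolding f by (simp add: lead_coeff_mult del: mult_pCons_left)
  have "g = Polynomial.smult (lead_coeff g) (\<Prod>x\<in>#proots g. [:-x, 1:])"
    using Suc g roots by (intro Suc.hyps) auto
  then have "f = [:-x, 1:] * Polynomial.smult (lead_coeff g) (\<Prod>x\<in>#proots g. [:-x, 1:])"
    using f by simp
  then show ?case
    unfolding roots lead by simp
qed

lemma poly_prod_mset_linear: "poly (\<Prod>x\<in>#A. [:-x, 1:]) y = (\<Prod>x\<in>#A. y - x)"
  for y :: "'b::comm_ring_1"
  by (induction A) (auto simp: algebra_simps)

lemma poly_eq_prod_diff_proots:
  fixes f :: "'b::field poly"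
  assumes "size (proots f) = degree f"
  shows "poly f y = lead_coeff f * (\<Prod>x\<in>#proots f. y - x)"
  by (subst poly_eq_prod_proots[OF assms]) (simp only: poly_smult poly_prod_mset_linear)

context Cp
begin

text \<open>If the leading term strictly dominates the sum of the others, there is no cancellation. All bounds on
  roots of monic polynomials below come from this.\<close>

lemma poly_nonzero_if_lead_dominates:
  assumes "lead_coeff f = 1"
    and dom: "\<And>i. i < degree f \<Longrightarrow> absv (coeff f i) * absv x ^ i < absv x ^ degree f"
  shows "poly f x \<noteq> 0"
proof (cases "degree f = 0")
  case True
  with assms(1) have "f = 1"
    by (metis degree_0_id one_pCons coeff_pCons_0 degree_eq_zeroE)
  then show ?thesis
    by simp
next
  case False
  have "0 < absv x ^ degree f"
    using dom[of 0] False by (smt (verit) absv_nonneg mult_nonneg_nonneg neq0_conv zero_le_power)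
  then have "absv (\<Sum>i<degree f. coeff f i * x ^ i) < absv x ^ degree f"
    using dom by (intro absv_sum_less) (auto simp: absv_mult absv_power)
  moreover have "poly f x = (\<Sum>i<degree f. coeff f i * x ^ i) + x ^ degree f"
    using assms(1) by (simp add: poly_altdef flip: lessThan_Suc_atMost)
  ultimately show ?thesis
    by (metis absv_minus absv_power add_eq_0_iff order_less_irrefl)
qed

lemma root_of_monic_bounded:
  assumes "lead_coeff f = 1" "1 \<le> B" "\<And>i. absv (coeff f i) \<le> B" "poly f x = 0"
  shows "absv x \<le> B"
proof (rule ccontr)
  assume "\<not> absv x \<le> B"
  with \<open>1 \<le> B\<close> have x: "B < absv x" "1 < absv x"
    by auto
  have "poly f x \<noteq> 0"
  proof (rule poly_nonzero_if_lead_dominates[OF assms(1)])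
    fix i assume "i < degree f"
    have "absv (coeff f i) * absv x ^ i \<le> B * absv x ^ i"
      using assms(3) by (intro mult_right_mono) auto
    also have "\<dots> < absv x ^ Suc i"
      using x \<open>1 \<le> B\<close> by (simp add: mult_strict_right_mono del: absv_pos_iff)
    also have "\<dots> \<le> absv x ^ degree f"
      using x \<open>i < degree f\<close> by (intro power_increasing) auto
    finally show "absv (coeff f i) * absv x ^ i < absv x ^ degree f" .
  qed
  with assms(4) show False
    by simp
qed

lemma zero_one_in_Qp_bar: "(0 :: 'a) \<in> Qp_bar" "(1 :: 'a) \<in> Qp_bar"
proof -
  have rat: "q \<in> Qp" if "q \<in> \<rat>" for q :: 'a
    using that closure_subset[of \<rat>] by (auto simp: Qp_def)
  have "\<forall>i. coeff [:- c, 1:] i \<in> Qp" if "c \<in> \<rat>" for c :: 'a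
    using that by (auto simp: coeff_pCons split: nat.splits intro!: rat)
  then have "c \<in> Qp_bar" if "c \<in> \<rat>" for c :: 'a
    using that unfolding Qp_bar_def mem_Collect_eq by (intro exI[of _ "[:- c, 1:]"]) auto
  then show "(0 :: 'a) \<in> Qp_bar" "(1 :: 'a) \<in> Qp_bar"
    by auto
qed

lemma ex_Qp_bar_close: "0 < e \<Longrightarrow> \<exists>y\<in>Qp_bar. absv (y - x) < e"
  for x :: 'a
proof -
  assume "0 < e"
  moreover have "x \<in> closure Qp_bar"
    by (simp add: Qp_bar_dense)
  ultimately show ?thesis
    unfolding closure_approachable by (simp add: dist_absv)
qed

text \<open>A monic polynomial over \<open>Qp_bar\<close> whose coefficients are close to those of \<open>f\<close> has a root, and its roots
  lie in a ball that depends on \<open>f\<close> only; hence \<open>f\<close> is small at such a root.\<close>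

lemma ex_approximate_root:
  assumes f: "lead_coeff f = 1" "0 < degree f" and "0 < e"
  shows "\<exists>x. absv (poly f x) < e"
proof -
  define n where "n = degree f"
  define B where "B = Max (insert 1 ((\<lambda>i. absv (coeff f i)) ` {..n}))"
  have B: "1 \<le> B" "absv (coeff f i) \<le> B" for i
  proof -
    show "1 \<le> B"
      unfolding B_def by (intro Max_ge) auto
    show "absv (coeff f i) \<le> B"
    proof (cases "i \<le> n")
      case True
      then show ?thesis
        unfolding B_def by (intro Max_ge) auto
    next
      case False
      with \<open>1 \<le> B\<close> show ?thesis
        by (simp add: coeff_eq_0 n_def)
    qed
  qed
  \<comment> \<open>Perturbing by at most 1 keeps the coefficients, hence the roots, bounded by \<open>B\<close>.\<close>
  define d where "d = min 1 (e / B ^ n)"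
  have d: "0 < d" "d \<le> 1" "d * B ^ n \<le> e"
    using \<open>0 < e\<close> B(1) by (auto simp: d_def min_def field_simps)
  obtain q where q: "q i \<in> Qp_bar" "absv (q i - coeff f i) < d" for i
    using that bchoice[of UNIV "\<lambda>i y. y \<in> Qp_bar \<and> absv (y - coeff f i) < d"] ex_Qp_bar_close[OF d(1)]
    by blast
  define c where "c i = (if i < n then q i else if i = n then 1 else 0)" for i
  define g where "g = (\<Sum>i\<le>n. monom (c i) i)"
  have coeff_g: "coeff g i = c i" for i
    by (auto simp: g_def coeff_sum c_def)
  have c: "c i \<in> Qp_bar" "absv (c i - coeff f i) < d" for i
    using q[of i] d(1) f(1) zero_one_in_Qp_bar by (auto simp: c_def n_def coeff_eq_0)
  have c_le: "absv (c i) \<le> B" for i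
    using absv_add[of "c i - coeff f i" "coeff f i"] c(2)[of i] d(2) B(1) B(2)[of i] by auto
  have "degree g = n"
  proof (rule antisym)
    show "degree g \<le> n"
      by (intro degree_le) (auto simp: coeff_g c_def)
    show "n \<le> degree g"
      by (intro le_degree) (simp add: coeff_g c_def)
  qed
  then have "lead_coeff g = 1"
    by (simp add: coeff_g c_def)
  obtain x where x: "poly g x = 0"
    using Qp_bar_alg_closed[of g] c(1) f(2) \<open>degree g = n\<close> by (auto simp: coeff_g n_def)
  have x_le: "absv x \<le> B"
    using root_of_monic_bounded[OF \<open>lead_coeff g = 1\<close> B(1) _ x] c_le by (simp add: coeff_g)
  have "absv (\<Sum>i\<le>n. (coeff f i - c i) * x ^ i) < e"
  proof (intro absv_sum_less)
    fix i assume "i \<in> {..n}"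
    have "absv x ^ i \<le> B ^ i"
      using x_le by (intro power_mono) auto
    also have "\<dots> \<le> B ^ n"
      using \<open>i \<in> {..n}\<close> B(1) by (intro power_increasing) auto
    finally have "absv (coeff f i - c i) * absv x ^ i \<le> absv (coeff f i - c i) * B ^ n"
      by (intro mult_left_mono) auto
    also have "\<dots> < d * B ^ n"
      using c(2)[of i] B(1) by (intro mult_strict_right_mono) (auto simp: absv_diff_commute)
    finally show "absv ((coeff f i - c i) * x ^ i) < e"
      using d(3) by (simp add: absv_mult absv_power)
  qed (use \<open>0 < e\<close> in auto)
  also have "(\<Sum>i\<le>n. (coeff f i - c i) * x ^ i) = poly f x - poly g x"
    unfolding poly_altdef \<open>degree g = n\<close>
    by (simp add: coeff_g left_diff_distrib sum_subtractf n_def)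
  finally show ?thesis
    using x by auto
qed

text \<open>The value \<open>\<bar>g(x)\<bar>\<close> is the product of the distances from \<open>x\<close> to the roots, so it is at least the
  appropriate power of the smallest distance.\<close>

lemma root_near_small_value:
  assumes split: "size (proots g) = degree g" and "lead_coeff g = 1" "0 < degree g"
  shows "\<exists>y. poly g y = 0 \<and> absv (x - y) ^ degree g \<le> absv (poly g x)"
proof -
  have "g \<noteq> 0"
    using assms(3) by auto
  define M where "M = Min ((\<lambda>y. absv (x - y)) ` set_mset (proots g))"
  have "set_mset (proots g) \<noteq> {}"
    using assms by (metis less_irrefl set_mset_eq_empty_iff size_empty)
  then have "M \<in> (\<lambda>y. absv (x - y)) ` set_mset (proots g)"
    unfolding M_def by (intro Min_in) auto
  then obtain y where y: "y \<in># proots g" "M = absv (x - y)"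
    by auto
  have M_le: "M \<le> absv (x - z)" if "z \<in># proots g" for z
    using that unfolding M_def by (intro Min_le) auto
  have "0 \<le> M"
    using y by simp
  have "M ^ size A \<le> (\<Prod>z\<in>#A. absv (x - z))" if "\<And>z. z \<in># A \<Longrightarrow> M \<le> absv (x - z)" for A
    using that \<open>0 \<le> M\<close> by (induction A) (auto intro!: mult_mono)
  from this[of "proots g"] have "M ^ degree g \<le> absv (poly g x)"
    using M_le split assms(2) by (simp add: poly_eq_prod_diff_proots[OF split] absv_prod_mset)
  with y \<open>g \<noteq> 0\<close> show ?thesis
    by auto
qed

text \<open>Approximate roots of \<open>f\<close> could a priori jump between different true roots. They are made into a Cauchy
  sequence as follows: for each approximate root \<open>b\<close>, the polynomial \<open>f - f(b)\<close> has the root \<open>b\<close>, hence splits by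
  induction, so near a given point \<open>x\<close> there is some \<open>y\<close> with \<open>f(y) = f(b)\<close>, at a distance controlled by
  \<open>\<bar>f(x) - f(b)\<bar>\<close>.\<close>

theorem alg_closed:
  fixes f :: "'a poly"
  assumes "0 < degree f"
  shows "\<exists>x. poly f x = 0"
  using assms
proof (induction "degree f" arbitrary: f rule: less_induct)
  case (less f0)
  define f where "f = Polynomial.smult (inverse (lead_coeff f0)) f0"
  have "f0 \<noteq> 0"
    using less.prems by auto
  then have f: "lead_coeff f = 1" "degree f = degree f0"
    by (auto simp: f_def)
  define n where "n = degree f"
  have n: "0 < n"
    using less.prems f by (simp add: n_def)
  have step: "\<exists>y. poly f y = poly f b \<and> absv (x - y) ^ n \<le> absv (poly f x - poly f b)" for x b
  proof -
    define g where "g = f - [:poly f b:]"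
    have g: "degree g = n" "lead_coeff g = 1"
    proof -
      show "degree g = n"
        unfolding g_def n_def diff_conv_add_uminus using n by (subst degree_add_eq_left) (auto simp: n_def)
      then show "lead_coeff g = 1"
        using n f(1) by (auto simp: g_def n_def coeff_pCons split: nat.splits)
    qed
    have "size (proots g) = degree g"
    proof (rule size_proots_if_root)
      show "\<exists>x. poly g x = 0"
        by (intro exI[of _ b]) (simp add: g_def)
      show "g \<noteq> 0"
        using g n by auto
    qed (use less.hyps f g in \<open>auto simp: n_def\<close>)
    from root_near_small_value[OF this g(2), of x] show ?thesis
      using g n by (simp add: g_def)
  qed
  \<comment> \<open>The bounds are \<open>n\<close>-th powers because \<open>step\<close> controls only the \<open>n\<close>-th power of the distance.\<close>
  have approx: "\<exists>b. absv (poly f b) \<le> ((1/2) ^ n) ^ k" for k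
    using ex_approximate_root[OF f(1), of "((1/2) ^ n) ^ k"] n by (auto simp: n_def intro: less_imp_le)
  have "\<exists>y. \<forall>k. absv (poly f (y k)) \<le> ((1/2) ^ n) ^ k \<and> absv (y (Suc k) - y k) \<le> (1/2) ^ k"
  proof (rule dependent_nat_choice)
    show "\<exists>x. absv (poly f x) \<le> ((1/2) ^ n) ^ 0"
      using approx .
    fix x k assume x: "absv (poly f x) \<le> ((1/2) ^ n) ^ k"
    obtain b where b: "absv (poly f b) \<le> ((1/2) ^ n) ^ Suc k"
      using approx by blast
    obtain y where y: "poly f y = poly f b" "absv (x - y) ^ n \<le> absv (poly f x - poly f b)"
      using step by blast
    have "((1/2 :: real) ^ n) ^ Suc k \<le> ((1/2) ^ n) ^ k"
      by (intro power_decreasing) (auto simp: power_le_one)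
    then have "absv (poly f x - poly f b) \<le> ((1/2) ^ n) ^ k"
      using absv_diff[of "poly f x" "poly f b"] x b by linarith
    then have "absv (x - y) ^ n \<le> ((1/2) ^ k) ^ n"
      using y(2) by (simp add: power_mult[symmetric] mult.commute)
    then have "absv (y - x) \<le> (1/2) ^ k"
      using n power_le_imp_le_base[of _ "n - 1"] by (simp add: absv_diff_commute power_mono_iff)
    with y b show "\<exists>y. absv (poly f y) \<le> ((1/2) ^ n) ^ Suc k \<and> absv (y - x) \<le> (1/2) ^ k"
      by (intro exI[of _ y]) simp
  qed
  then obtain y where y: "\<And>k. absv (poly f (y k)) \<le> ((1/2) ^ n) ^ k" "\<And>k. absv (y (Suc k) - y k) \<le> (1/2) ^ k"
    by blast
  obtain l where "y \<longlonglongrightarrow> l"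
    using convergent_if_geometric_steps[OF _ _ y(2)] by (auto simp: convergent_def)
  then have "(\<lambda>k. poly f (y k)) \<longlonglongrightarrow> poly f l"
    by (rule tendsto_poly_Cp)
  moreover have "(\<lambda>k. poly f (y k)) \<longlonglongrightarrow> 0"
    unfolding tendsto_absv_iff
  proof (rule tendsto_sandwich)
    show "\<forall>\<^sub>F k in sequentially. 0 \<le> absv (poly f (y k) - 0)"
      by simp
    show "\<forall>\<^sub>F k in sequentially. absv (poly f (y k) - 0) \<le> ((1/2) ^ n) ^ k"
      using y(1) by simp
    show "(\<lambda>k. ((1/2 :: real) ^ n) ^ k) \<longlonglongrightarrow> 0"
      using n by (intro LIMSEQ_realpow_zero) (auto simp: power_less_one_iff)
    show "(\<lambda>k. 0) \<longlonglongrightarrow> (0 :: real)"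
      by (rule tendsto_const)
  qed
  ultimately have "poly f l = 0"
    by (rule LIMSEQ_unique)
  with \<open>f0 \<noteq> 0\<close> show ?case
    by (auto simp: f_def)
qed

lemma size_proots: "f \<noteq> 0 \<Longrightarrow> size (proots f) = degree f"
  for f :: "'a poly"
  by (intro size_proots_if_root alg_closed)

end


section \<open>Resultants of split polynomials\<close>

text \<open>Subresultant theory treats separately the cases of a remainder of positive degree and of a
  constant remainder; for the resultant they give the same formula, which also covers \<open>h = 0\<close>.\<close>

lemma resultant_Euclid_step:
  fixes f g h :: "'b::idom poly"
  assumes eq: "f = q * g + h" and deg: "degree g \<le> degree f" "degree h < degree g"
  shows "resultant f g = (-1) ^ (degree f * degree g) * lead_coeff g ^ (degree f - degree h) * resultant g h"
proof -
  have eq': "f + (- q) * g = h"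
    using eq by simp
  have "subresultant 0 f g = Polynomial.smult
      ((-1) ^ (degree f * degree g) * lead_coeff g ^ (degree f - degree h)) (subresultant 0 g h)"
  proof (cases "degree h = 0")
    case False
    then show ?thesis
      using BT_lemma_1_12[OF eq' deg(1), of 0] deg(2) by simp
  next
    case True
    then obtain a where h: "h = [:a:]"
      by (metis degree_eq_zeroE)
    have "a ^ (degree g - 1) * a = a ^ degree g"
      using deg(2) by (cases "degree g") auto
    then show ?thesis
      using BT_lemma_1_13'[OF eq' deg(1), of 0] deg(2)
      by (simp add: h subresultant_resultant mult.assoc)
  qed
  then show ?thesis
    by (simp add: subresultant_resultant)
qed

lemma prod_mset_poly_eq_prod_diff:
  fixes g :: "'b::field poly"
  assumes "size (proots g) = degree g"
  shows "(\<Prod>x\<in>#A. poly g x) = lead_coeff g ^ size A * (\<Prod>x\<in>#A. \<Prod>y\<in>#proots g. x - y)"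
proof (induction A)
  case (add x A)
  then show ?case
    by (simp add: poly_eq_prod_diff_proots[OF assms, of x])
qed simp

lemma prod_mset_diff_swap:
  fixes A B :: "'b::comm_ring_1 multiset"
  shows "(\<Prod>x\<in>#A. \<Prod>y\<in>#B. x - y) = (-1) ^ (size A * size B) * (\<Prod>y\<in>#B. \<Prod>x\<in>#A. y - x)"
proof (induction A)
  case (add a A)
  have "(\<Prod>y\<in>#B. a - y) = (-1) ^ size B * (\<Prod>y\<in>#B. y - a)"
  proof (induction B)
    case (add b B)
    then show ?case
      by (simp add: algebra_simps)
  qed simp
  moreover have "(\<Prod>y\<in>#B. \<Prod>x\<in>#add_mset a A. y - x) = (\<Prod>y\<in>#B. y - a) * (\<Prod>y\<in>#B. \<Prod>x\<in>#A. y - x)"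
    by (simp add: prod_mset.distrib)
  ultimately show ?case
    using add.IH by (simp add: power_add mult_ac)
qed simp

context
  assumes splits: "\<And>f::'b::field poly. f \<noteq> 0 \<Longrightarrow> size (proots f) = degree f"
begin

text \<open>The product that will turn out to be the resultant changes under exchange of \<open>f\<close> and \<open>g\<close> by the same
  sign as the resultant.\<close>

lemma prod_proots_swap:
  fixes f g :: "'b poly"
  assumes "f \<noteq> 0" "g \<noteq> 0"
  shows "lead_coeff f ^ degree g * (\<Prod>x\<in>#proots f. poly g x) =
    (-1) ^ (degree f * degree g) * (lead_coeff g ^ degree f * (\<Prod>y\<in>#proots g. poly f y))"
  unfolding prod_mset_poly_eq_prod_diff[OF splits[OF assms(1)]]
    prod_mset_poly_eq_prod_diff[OF splits[OF assms(2)]]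
    prod_mset_diff_swap[where A = "proots f" and B = "proots g"] splits[OF assms(1)] splits[OF assms(2)]
  by (simp only: mult.left_commute)

text \<open>At the roots of \<open>g\<close> the values of \<open>f\<close> and of \<open>h = f mod g\<close> agree, so both sides change by the same sign
  and the same power of the leading coefficient of \<open>g\<close> when \<open>(f, g)\<close> is replaced by
  \<open>(g, h)\<close>. As \<open>f\<close> and \<open>g\<close> exchange their roles in each step, the roots of all remainders occur, which is why the splitting hypothesis is about all polynomials.\<close>

theorem resultant_eq_prod_proots:
  fixes f g :: "'b poly"
  assumes "f \<noteq> 0" "g \<noteq> 0"
  shows "resultant f g = lead_coeff f ^ degree g * (\<Prod>x\<in>#proots f. poly g x)"
proof -
  have ordered: "resultant f g = lead_coeff f ^ degree g * (\<Prod>x\<in>#proots f. poly g x)"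
    if "f \<noteq> 0" "g \<noteq> 0" "degree g \<le> degree f" for f g :: "'b poly"
    using that
  proof (induction "degree g" arbitrary: f g rule: less_induct)
    case less
    have const: "resultant f [:a:] = lead_coeff f ^ degree [:a:] * (\<Prod>x\<in>#proots f. poly [:a:] x)"
      if "f \<noteq> 0" for f :: "'b poly" and a
      using splits[OF that] by (simp add: prod_mset_constant)
    show ?case
    proof (cases "degree g = 0")
      case True
      then show ?thesis
        using const[OF less.prems(1)] by (metis degree_eq_zeroE)
    next
      case False
      define h where "h = f mod g"
      have eq: "f = f div g * g + h"
        by (simp add: h_def)
      have deg: "degree h < degree g"
        using degree_mod_less[of g f] False less.prems(2) by (auto simp: h_def)
      have "resultant g h = lead_coeff g ^ degree h * (\<Prod>x\<in>#proots g. poly h x)"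
      proof (cases "degree h = 0")
        case True
        then show ?thesis
          using const[OF less.prems(2)] by (metis degree_eq_zeroE)
      next
        case False
        then show ?thesis
          using less.hyps[of h g] less.prems(2) deg by force
      qed
      moreover have "(\<Prod>x\<in>#proots g. poly h x) = (\<Prod>x\<in>#proots g. poly f x)"
      proof (intro arg_cong[of _ _ prod_mset] image_mset_cong)
        fix x assume "x \<in># proots g"
        then have "poly g x = 0"
          using less.prems(2) by simp
        then show "poly h x = poly f x"
          using arg_cong[OF eq, of "\<lambda>f. poly f x"] by simp
      qed
      moreover have "lead_coeff g ^ (degree f - degree h) * lead_coeff g ^ degree h = lead_coeff g ^ degree f"
        using deg less.prems(3) by (simp flip: power_add)
      ultimately have "resultant f g =
          (-1) ^ (degree f * degree g) * (lead_coeff g ^ degree f * (\<Prod>x\<in>#proots g. poly f x))"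
        unfolding resultant_Euclid_step[OF eq less.prems(3) deg] by (simp add: mult.assoc)
      then show ?thesis
        unfolding prod_proots_swap[OF less.prems(1,2)] .
    qed
  qed
  show ?thesis
  proof (cases "degree g \<le> degree f")
    case False
    then have "resultant f g = (-1) ^ (degree f * degree g) * (lead_coeff g ^ degree f * (\<Prod>y\<in>#proots g. poly f y))"
      using resultant_swap[of f g] ordered[OF assms(2,1)] by simp
    then show ?thesis
      unfolding prod_proots_swap[OF assms] .
  qed (rule ordered[OF assms])
qed

lemma resultant_eq_prod_diff_proots:
  fixes f g :: "'b poly"
  assumes "f \<noteq> 0" "g \<noteq> 0"
  shows "resultant f g = lead_coeff f ^ degree g * lead_coeff g ^ degree f *
    (\<Prod>x\<in>#proots f. \<Prod>y\<in>#proots g. x - y)"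
  unfolding resultant_eq_prod_proots[OF assms] prod_mset_poly_eq_prod_diff[OF splits[OF assms(2)]]
  by (simp add: splits[OF assms(1)])

end

section \<open>The inequality for the supremum\<close>

text \<open>In the two lemmas that follow, \<open>s i\<close> and \<open>t j\<close> are the distances from a point \<open>x\<close> to the roots \<open>z\<^sub>i\<close> of \<open>F\<close>
  and \<open>w\<^sub>j\<close> of \<open>G\<close>, and \<open>m i j\<close> is the distance from \<open>z\<^sub>i\<close> to \<open>w\<^sub>j\<close>.\<close>

text \<open>The root with index \<open>i0\<close> is at least as near to \<open>x\<close> as every \<open>w\<^sub>j\<close>. Its row of the double product is at most \<open>\<Prod>\<^sub>j t j\<close>, and
  the other rows are at most 1.\<close>

lemma resultant_bound_oriented:
  fixes s :: "'i \<Rightarrow> real" and t :: "'j \<Rightarrow> real"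
  assumes fin: "finite I" "finite J"
    and m: "\<And>i j. i \<in> I \<Longrightarrow> j \<in> J \<Longrightarrow> 0 \<le> m i j \<and> m i j \<le> max (s i) (t j)"
    and s: "\<And>i. i \<in> I \<Longrightarrow> s i \<le> 1" and t: "\<And>j. j \<in> J \<Longrightarrow> t j \<le> 1"
    and c: "0 \<le> c" "c \<le> 1" and d: "0 \<le> d" "d \<le> 1"
    and i0: "i0 \<in> I" "\<And>j. j \<in> J \<Longrightarrow> s i0 \<le> t j"
  shows "c ^ card J * d ^ card I * (\<Prod>i\<in>I. \<Prod>j\<in>J. m i j) \<le> d * (\<Prod>j\<in>J. t j)"
proof -
  have m1: "0 \<le> m i j" "m i j \<le> 1" if "i \<in> I" "j \<in> J" for i j
    using m[OF that] s[OF that(1)] t[OF that(2)] by auto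
  have "(\<Prod>i\<in>I. \<Prod>j\<in>J. m i j) = (\<Prod>j\<in>J. m i0 j) * (\<Prod>i\<in>I - {i0}. \<Prod>j\<in>J. m i j)"
    using fin i0 by (simp add: prod.remove)
  also have "\<dots> \<le> (\<Prod>j\<in>J. t j) * 1"
  proof (intro mult_mono)
    show "(\<Prod>j\<in>J. m i0 j) \<le> (\<Prod>j\<in>J. t j)"
      using m1 m[OF i0(1)] i0 by (intro prod_mono) (auto simp: max_def split: if_splits)
    show "(\<Prod>i\<in>I - {i0}. \<Prod>j\<in>J. m i j) \<le> 1"
      using m1 by (intro prod_le_1 conjI prod_nonneg) auto
    have "0 \<le> t j" if "j \<in> J" for j
      using m[OF i0(1) that] i0(2)[OF that] by auto
    then show "0 \<le> (\<Prod>j\<in>J. t j)"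
      by (intro prod_nonneg) auto
    show "0 \<le> (\<Prod>i\<in>I - {i0}. \<Prod>j\<in>J. m i j)"
      using m1 by (intro prod_nonneg) auto
  qed
  finally have prod: "(\<Prod>i\<in>I. \<Prod>j\<in>J. m i j) \<le> (\<Prod>j\<in>J. t j)"
    by simp
  have nonneg: "0 \<le> (\<Prod>i\<in>I. \<Prod>j\<in>J. m i j)"
    using m1 by (intro prod_nonneg) auto
  \<comment> \<open>One of the factors \<open>d\<close> has to survive, and there is one since \<open>i0\<close> is an element of \<open>I\<close>.\<close>
  have "0 < card I"
    using fin i0 by (auto simp: card_gt_0_iff)
  then have "d ^ card I \<le> d ^ 1"
    using d by (intro power_decreasing) auto
  then have "c ^ card J * d ^ card I \<le> 1 * d"
    using c d by (intro mult_mono) (auto simp: power_le_one)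
  then show ?thesis
    using prod nonneg c d by (intro mult_mono) auto
qed

text \<open>If there are no roots at all, the left-hand side is 1 and the right-hand side is \<open>max c d\<close>, hence the
  extra hypothesis in this case.\<close>

lemma resultant_bound:
  fixes s :: "'i \<Rightarrow> real" and t :: "'j \<Rightarrow> real"
  assumes fin: "finite I" "finite J"
    and m: "\<And>i j. i \<in> I \<Longrightarrow> j \<in> J \<Longrightarrow> 0 \<le> m i j \<and> m i j \<le> max (s i) (t j)"
    and s: "\<And>i. i \<in> I \<Longrightarrow> s i \<le> 1" and t: "\<And>j. j \<in> J \<Longrightarrow> t j \<le> 1"
    and c: "0 \<le> c" "c \<le> 1" and d: "0 \<le> d" "d \<le> 1"
    and nondeg: "I = {} \<Longrightarrow> J = {} \<Longrightarrow> c = 1 \<or> d = 1"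
  shows "c ^ card J * d ^ card I * (\<Prod>i\<in>I. \<Prod>j\<in>J. m i j) \<le> max (c * (\<Prod>i\<in>I. s i)) (d * (\<Prod>j\<in>J. t j))"
proof -
  have swap: "(\<Prod>i\<in>I. \<Prod>j\<in>J. m i j) = (\<Prod>j\<in>J. \<Prod>i\<in>I. m i j)"
    by (rule prod.swap)
  consider "I = {}" "J = {}" | i0 where "i0 \<in> I" "\<And>j. j \<in> J \<Longrightarrow> s i0 \<le> t j"
    | j0 where "j0 \<in> J" "\<And>i. i \<in> I \<Longrightarrow> t j0 \<le> s i"
  proof -
    show thesis
    proof (cases "I = {} \<or> J = {}")
      case False
      then obtain i0 where i0: "i0 \<in> I" "\<forall>i\<in>I. s i0 \<le> s i"
        using ex_is_arg_min_if_finite[OF fin(1), of s] by (auto simp: is_arg_min_linorder)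
      from False obtain j0 where j0: "j0 \<in> J" "\<forall>j\<in>J. t j0 \<le> t j"
        using ex_is_arg_min_if_finite[OF fin(2), of t] by (auto simp: is_arg_min_linorder)
      show thesis
      proof (cases "s i0 \<le> t j0")
        case True
        with i0 j0 show thesis by (intro that(2)[of i0]) (auto intro: order_trans)
      next
        case False
        with i0 j0 show thesis by (intro that(3)[of j0]) force+
      qed
    qed (use that in auto)
  qed
  then show ?thesis
  proof cases
    case 1
    with nondeg show ?thesis
      by auto
  next
    case 2
    then have "c ^ card J * d ^ card I * (\<Prod>i\<in>I. \<Prod>j\<in>J. m i j) \<le> d * (\<Prod>j\<in>J. t j)"
      by (intro resultant_bound_oriented[where s = s] fin m s t c d)
    then show ?thesis
      by (rule max.coboundedI2)
  next
    case 3
    have "0 \<le> m i j \<and> m i j \<le> max (t j) (s i)" if "j \<in> J" "i \<in> I" for i j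
      using m[OF that(2,1)] by (simp add: max.commute)
    then have "d ^ card I * c ^ card J * (\<Prod>j\<in>J. \<Prod>i\<in>I. m i j) \<le> c * (\<Prod>i\<in>I. s i)"
      using 3 by (intro resultant_bound_oriented[where s = t] fin s t c d)
    then show ?thesis
      unfolding swap by (intro max.coboundedI1) (simp add: mult.commute[of "d ^ card I"])
  qed
qed


section \<open>Weierstrass factorizations\<close>

text \<open>The common content of the open and the closed case, with \<open>D\<close> one of the two discs. The condition
  \<open>absv_h\<close> replaces the two different conditions on the coefficients of the unit factor.\<close>

locale weierstrass_factorization = Cp p v
  for p :: nat and v :: "'a::{field_char_0, complete_space} \<Rightarrow> ereal" +
  fixes D :: "'a set" and F :: "'a fps" and c :: 'a and P :: "'a poly" and h :: "'a fps"
  assumes factorization: "F = fps_const c * fps_of_poly P * h"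
    and c_nonzero: "c \<noteq> 0" and c_le_1: "absv c \<le> 1"
    and monic: "lead_coeff P = 1"
    and roots_in_D: "\<And>x. poly P x = 0 \<Longrightarrow> x \<in> D"
    and D_le_1: "\<And>x. x \<in> D \<Longrightarrow> absv x \<le> 1"
    and converges_h: "converges_on D h"
    and absv_h: "\<And>x. x \<in> D \<Longrightarrow> absv (ps_eval h x) = 1"
begin

lemma P_nonzero: "P \<noteq> 0"
  using monic by auto

lemma factorization_poly: "F = fps_of_poly (Polynomial.smult c P) * h"
  using factorization by (simp add: fps_of_poly_smult)

lemma ps_eval_eq: "x \<in> D \<Longrightarrow> ps_eval F x = c * poly P x * ps_eval h x"
  unfolding factorization_poly by (subst ps_eval_poly_mult[OF converges_h]) auto

lemma absv_ps_eval: "x \<in> D \<Longrightarrow> absv (ps_eval F x) = absv (c * poly P x)"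
  by (simp add: ps_eval_eq absv_mult absv_h)

lemma absv_ps_eval_eq_prod:
  "x \<in> D \<Longrightarrow> absv (ps_eval F x) = absv c * (\<Prod>z\<in>#proots P. absv (x - z))"
  using poly_eq_prod_diff_proots[OF size_proots[OF P_nonzero], of x]
  by (simp add: absv_ps_eval absv_mult monic absv_prod_mset)

lemma ps_roots_eq: "ps_roots D F = set_mset (proots P)"
proof -
  have "ps_eval F x = 0 \<longleftrightarrow> poly P x = 0" if "x \<in> D" for x
    using absv_ps_eval[OF that] c_nonzero by (metis absv_eq_0_iff mult_eq_0_iff)
  then show ?thesis
    using roots_in_D P_nonzero by (auto simp: ps_roots_def)
qed

text \<open>Beyond the power of \<open>X - z\<close> that divides \<open>P\<close>, a further factor would, after cancellation, make
  \<open>c q h\<close> vanish at \<open>z\<close>, where \<open>q\<close> is the part of \<open>P\<close> prime to \<open>X - z\<close>. This needs the value of the cofactor at \<open>z\<close>,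
  hence its convergence.\<close>

lemma divisible_iff:
  assumes "z \<in> D"
  shows "(\<exists>H. converges_on D H \<and> F = (fps_X - fps_const z) ^ k * H) \<longleftrightarrow> k \<le> order z P"
proof -
  define l where "l = [:-z, 1:]"
  have l: "fps_X - fps_const z = fps_of_poly l"
    by (simp add: l_def fps_of_poly_pCons fps_const_neg[symmetric] del: fps_const_neg)
  obtain q where q: "P = l ^ order z P * q" "poly q z \<noteq> 0"
    using order_decomp[OF P_nonzero, of z] unfolding l_def
    by (metis order_root order_0I poly_eq_0_iff_dvd)
  have F: "F = fps_of_poly l ^ order z P * (fps_of_poly (Polynomial.smult c q) * h)"
    unfolding factorization_poly
    by (subst q(1)) (simp add: fps_of_poly_mult fps_of_poly_power fps_of_poly_smult mult_ac)
  show ?thesis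
    unfolding l
  proof
    assume "k \<le> order z P"
    then have "F = fps_of_poly l ^ k * (fps_of_poly (l ^ (order z P - k) * Polynomial.smult c q) * h)"
      by (subst F) (simp add: fps_of_poly_mult fps_of_poly_power mult.assoc flip: power_add mult.assoc)
    then show "\<exists>H. converges_on D H \<and> F = fps_of_poly l ^ k * H"
      using converges_on_poly_mult[OF converges_h] by blast
  next
    assume "\<exists>H. converges_on D H \<and> F = fps_of_poly l ^ k * H"
    then obtain H where H: "converges_on D H" "F = fps_of_poly l ^ k * H"
      by blast
    show "k \<le> order z P"
    proof (rule ccontr)
      assume "\<not> k \<le> order z P"
      then obtain j where j: "k = order z P + Suc j"
        by (metis less_iff_Suc_add not_le_imp_less add_Suc_right)
      have "fps_of_poly l \<noteq> 0"
        by (simp add: l_def)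
      moreover have "fps_of_poly l ^ order z P * (fps_of_poly (Polynomial.smult c q) * h) =
          fps_of_poly l ^ order z P * (fps_of_poly (l ^ Suc j) * H)"
        using F H(2) by (simp only: j power_add fps_of_poly_power mult.assoc)
      ultimately have "fps_of_poly (Polynomial.smult c q) * h = fps_of_poly (l ^ Suc j) * H"
        by (simp only: mult_cancel_left power_eq_0_iff) auto
      then have "poly (Polynomial.smult c q) z * ps_eval h z = poly (l ^ Suc j) z * ps_eval H z"
        using ps_eval_poly_mult[OF converges_h assms] ps_eval_poly_mult[OF H(1) assms] by metis
      then have "c * poly q z * ps_eval h z = 0"
        by (simp add: l_def)
      moreover have "ps_eval h z \<noteq> 0"
        using absv_h[OF assms] by auto
      ultimately show False
        using c_nonzero q(2) by simp
    qed
  qed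
qed

lemma root_mult_eq: "z \<in> D \<Longrightarrow> root_mult D F z = order z P"
  unfolding root_mult_def divisible_iff by (rule Least_equality) auto

text \<open>As a statement about multisets, an enumeration of the roots can be substituted into products over
  \<open>proots P\<close>.\<close>

lemma enumerates_roots_iff:
  "enumerates_roots D F n z \<longleftrightarrow> image_mset z (mset_set {1..n}) = proots P"
proof -
  have count: "count (image_mset z (mset_set {1..n})) x = card {i\<in>{1..n}. z i = x}" for x
    by (simp add: count_image_mset vimage_def Int_def conj_commute)
  have mult: "root_mult D F x = count (proots P) x" if "x \<in> ps_roots D F" for x
    using that root_mult_eq P_nonzero by (simp add: ps_roots_def)
  show ?thesis
  proof
    assume z: "enumerates_roots D F n z"
    show "image_mset z (mset_set {1..n}) = proots P"
    proof (rule multiset_eqI)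
      fix x
      show "count (image_mset z (mset_set {1..n})) x = count (proots P) x"
      proof (cases "x \<in> ps_roots D F")
        case True
        then show ?thesis
          using z mult unfolding enumerates_roots_def count by simp
      next
        case False
        then have "x \<notin># image_mset z (mset_set {1..n})" "x \<notin># proots P"
          using z by (simp_all add: enumerates_roots_def ps_roots_eq)
        then show ?thesis
          by (simp only: not_in_iff)
      qed
    qed
  next
    assume z: "image_mset z (mset_set {1..n}) = proots P"
    then have "z ` {1..n} = ps_roots D F"
      unfolding ps_roots_eq by (simp flip: z)
    then show "enumerates_roots D F n z"
      using mult count unfolding enumerates_roots_def z by simp
  qed
qed

lemma ex_enumerates_roots: "\<exists>z. enumerates_roots D F (degree P) z"
proof -
  obtain xs where xs: "mset xs = proots P"
    using ex_mset by blast
  then have "length xs = degree P"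
    using size_proots[OF P_nonzero] by (metis size_mset)
  then have "map (\<lambda>i. xs ! (i - 1)) [1..<Suc (degree P)] = xs"
    by (intro nth_equalityI) (auto simp del: upt_Suc)
  then have "image_mset (\<lambda>i. xs ! (i - 1)) (mset [1..<Suc (degree P)]) = proots P"
    using xs by (metis mset_map)
  then show ?thesis
    unfolding enumerates_roots_iff mset_upt atLeastLessThanSuc_atLeastAtMost by blast
qed

end

context Cp
begin

text \<open>The constant coefficient and that of the inverse series are integral with product 1.\<close>

lemma integral_unit_fps_0:
  assumes "integral_unit_fps v U"
  shows "absv (fps_nth U 0) = 1"
proof -
  obtain H where H: "integral_fps v U" "integral_fps v H" "U * H = 1"
    using assms by (auto simp: integral_unit_fps_def)
  have "absv (fps_nth U 0) * absv (fps_nth H 0) = 1"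
    using arg_cong[OF H(3), of "\<lambda>F. absv (fps_nth F 0)"] by (simp add: absv_mult)
  moreover have "absv (fps_nth U 0) \<le> 1" "absv (fps_nth H 0) \<le> 1"
    using H by (auto simp: integral_fps_def closed_disc_iff)
  ultimately show ?thesis
    using mult_left_le[of "absv (fps_nth H 0)" "absv (fps_nth U 0)"] by simp
qed

lemma weierstrass_factorization_open:
  assumes F: "integral_fps v F" and fin: "wideg_finite v F" and dist: "distinguished_open v F P"
  shows "\<exists>U. weierstrass_factorization p v (open_disc v) F (fps_nth F (wideg v F)) P U"
proof -
  define c where "c = fps_nth F (wideg v F)"
  obtain U where P: "lead_coeff P = 1" "\<And>i. i < degree P \<Longrightarrow> absv (coeff P i) < 1"
    and U: "integral_unit_fps v U" "F = fps_const c * fps_of_poly P * U"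
    using dist by (auto simp: distinguished_open_def c_def open_disc_iff)
  have conv: "converges_on (open_disc v) U"
    using U(1) by (intro integral_fps_converges_on_open_disc) (simp add: integral_unit_fps_def)
  have "weierstrass_factorization p v (open_disc v) F c P U"
  proof
    show "c \<noteq> 0"
      using U(2) fin by (auto simp: wideg_finite_def)
    show "absv c \<le> 1"
      using F by (simp add: c_def integral_fps_def closed_disc_iff)
    show "x \<in> open_disc v" if "poly P x = 0" for x
    proof (rule ccontr)
      assume "x \<notin> open_disc v"
      then have x: "1 \<le> absv x"
        by (simp add: open_disc_iff)
      have "absv (coeff P i) * absv x ^ i < absv x ^ degree P" if "i < degree P" for i
      proof -
        have "absv (coeff P i) * absv x ^ i < 1 * absv x ^ i"
          using P(2)[OF that] x by (intro mult_strict_right_mono zero_less_power) auto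
        also have "\<dots> \<le> absv x ^ degree P"
          using that x by (simp add: power_increasing)
        finally show ?thesis .
      qed
      with poly_nonzero_if_lead_dominates[OF P(1)] \<open>poly P x = 0\<close> show False
        by blast
    qed
    show "absv (ps_eval U x) = 1" if x: "x \<in> open_disc v" for x
      unfolding ps_eval_def
    proof (rule absv_suminf_eq_1)
      show "summable (\<lambda>i. fps_nth U i * x ^ i)"
        using conv x by (simp add: converges_on_def)
      show "absv (fps_nth U 0 * x ^ 0) = 1"
        using integral_unit_fps_0[OF U(1)] by simp
      fix i :: nat assume "0 < i"
      have "absv (fps_nth U i) * absv x ^ i \<le> 1 * absv x ^ i"
        using U(1) by (intro mult_right_mono) (auto simp: integral_unit_fps_def integral_fps_def closed_disc_iff)
      also have "\<dots> < 1"
        using x \<open>0 < i\<close> by (simp add: open_disc_iff power_less_one_iff)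
      finally show "absv (fps_nth U i * x ^ i) < 1"
        by (simp add: absv_mult absv_power)
    qed
  qed (use P U conv in \<open>auto simp: open_disc_iff\<close>)
  then show ?thesis
    unfolding c_def by blast
qed

text \<open>The coefficients of \<open>P\<close> are integral because \<open>c P = F H\<close>, where \<open>H\<close> is the inverse of \<open>h\<close> and \<open>c\<close> is a
  coefficient of \<open>F\<close> of maximal absolute value; so the roots of the monic \<open>P\<close> lie in the closed disc.\<close>

lemma weierstrass_factorization_closed:
  assumes F: "integral_fps v F" and fin: "Lwideg_finite v F" and dist: "distinguished_closed v F P"
  shows "\<exists>h. weierstrass_factorization p v (closed_disc v) F (fps_nth F (Lwideg v F)) P h"
proof -
  define c where "c = fps_nth F (Lwideg v F)"
  obtain h where P: "lead_coeff P = 1"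
    and h: "integral_unit_fps v h" "converges_on (closed_disc v) h"
      "absv (fps_nth h 0) = 1" "\<And>i. 0 < i \<Longrightarrow> absv (fps_nth h i) < 1"
      "F = fps_const c * fps_of_poly P * h"
    using dist integral_unit_fps_0 by (auto simp: distinguished_closed_def c_def absv_less_1_iff)
  have "Lwideg v F \<in> min_indices v F"
    using fin Max_in by (auto simp: Lwideg_finite_def Lwideg_def)
  then have c_max: "absv (fps_nth F i) \<le> absv c" for i
    by (simp add: min_indices_def absv_le_iff c_def)
  have c: "c \<noteq> 0"
  proof
    assume "c = 0"
    with h(5) have "min_indices v F = UNIV"
      by (auto simp: min_indices_def)
    with fin show False
      by (simp add: Lwideg_finite_def)
  qed
  have P_integral: "absv (coeff P k) \<le> 1" for k
  proof -
    obtain H where H: "integral_fps v H" "h * H = 1"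
      using h(1) by (auto simp: integral_unit_fps_def)
    have "F * H = fps_const c * fps_of_poly P * (h * H)"
      unfolding h(5) by (simp only: mult.assoc)
    then have "c * coeff P k = (\<Sum>i=0..k. fps_nth F i * fps_nth H (k - i))"
      unfolding H(2) by (simp flip: fps_mult_nth)
    also have "absv \<dots> \<le> absv c"
    proof (rule absv_sum_le)
      fix i
      have "absv (fps_nth F i) * absv (fps_nth H (k - i)) \<le> absv c * 1"
        using c_max H(1) by (intro mult_mono) (auto simp: integral_fps_def closed_disc_iff)
      then show "absv (fps_nth F i * fps_nth H (k - i)) \<le> absv c"
        by (simp add: absv_mult)
    qed simp
    finally show ?thesis
      using c by (simp add: absv_mult)
  qed
  have "weierstrass_factorization p v (closed_disc v) F c P h"
  proof
    show "absv c \<le> 1"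
      using F by (simp add: c_def integral_fps_def closed_disc_iff)
    show "x \<in> closed_disc v" if "poly P x = 0" for x
      using root_of_monic_bounded[OF P _ P_integral that] by (simp add: closed_disc_iff)
    show "absv (ps_eval h x) = 1" if x: "x \<in> closed_disc v" for x
      unfolding ps_eval_def
    proof (rule absv_suminf_eq_1)
      show "summable (\<lambda>i. fps_nth h i * x ^ i)"
        using h(2) x by (simp add: converges_on_def)
      show "absv (fps_nth h 0 * x ^ 0) = 1"
        using h(3) by simp
      fix i :: nat assume "0 < i"
      have "absv (fps_nth h i) * absv x ^ i \<le> absv (fps_nth h i) * 1"
        using x by (intro mult_left_mono) (auto simp: closed_disc_iff power_le_one)
      also have "\<dots> < 1"
        using h(4)[OF \<open>0 < i\<close>] by simp
      finally show "absv (fps_nth h i * x ^ i) < 1"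
        by (simp add: absv_mult absv_power)
    qed
  qed (use P h c in \<open>auto simp: closed_disc_iff\<close>)
  then show ?thesis
    unfolding c_def by blast
qed

end


section \<open>Resultants of power series\<close>

locale two_weierstrass_factorizations =
  Cp p v + F: weierstrass_factorization p v D F c P h + G: weierstrass_factorization p v D G d Q k
  for p :: nat and v :: "'a::{field_char_0, complete_space} \<Rightarrow> ereal"
    and D :: "'a set" and F c P h G d Q k
begin

abbreviation Res where
  "Res \<equiv> resultant (Polynomial.smult c P) (Polynomial.smult d Q)"

lemma Res_eq_prod_proots:
  "Res = c ^ degree Q * d ^ degree P * (\<Prod>x\<in>#proots P. \<Prod>y\<in>#proots Q. x - y)"
  using resultant_eq_prod_diff_proots[OF size_proots, of "Polynomial.smult c P" "Polynomial.smult d Q"]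
  by (simp add: F.c_nonzero G.c_nonzero F.P_nonzero G.P_nonzero F.monic G.monic)

lemma Res_eq_prod:
  assumes "enumerates_roots D F n z" "enumerates_roots D G N w" "n = degree P" "N = degree Q"
  shows "Res = c ^ N * d ^ n * (\<Prod>i=1..n. \<Prod>j=1..N. z i - w j)"
proof -
  have "image_mset z (mset_set {1..n}) = proots P" "image_mset w (mset_set {1..N}) = proots Q"
    using assms by (simp_all only: F.enumerates_roots_iff G.enumerates_roots_iff)
  then show ?thesis
    unfolding Res_eq_prod_proots prod_unfold_prod_mset assms(3,4)[symmetric]
    by (simp add: multiset.map_comp comp_def del: One_nat_def flip: \<open>_ = proots P\<close> \<open>_ = proots Q\<close>)
qed

text \<open>The product on the left is the resultant on \<open>D\<close>. It involves the values of \<open>G\<close> itself instead of those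
  of \<open>d Q\<close>, so the two sides differ by the values of the unit factor \<open>k\<close>, of absolute value 1.\<close>

lemma absv_Res_eq:
  "absv (c ^ degree Q * (\<Prod>z\<in>ps_roots D F. ps_eval G z ^ root_mult D F z)) = absv Res"
proof -
  have "(\<Prod>z\<in>ps_roots D F. ps_eval G z ^ root_mult D F z) = (\<Prod>z\<in>#proots P. ps_eval G z)"
    unfolding image_prod_mset_multiplicity F.ps_roots_eq[symmetric]
    by (intro prod.cong) (auto simp: ps_roots_def F.root_mult_eq F.P_nonzero)
  also have "absv \<dots> = (\<Prod>z\<in>#proots P. absv (d * (\<Prod>w\<in>#proots Q. z - w)))"
    unfolding absv_prod_mset using F.roots_in_D F.P_nonzero
    by (intro arg_cong[of _ _ prod_mset] image_mset_cong)
       (simp add: G.absv_ps_eval_eq_prod absv_mult absv_prod_mset)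
  also have "\<dots> = absv (d ^ degree P * (\<Prod>x\<in>#proots P. \<Prod>y\<in>#proots Q. x - y))"
    unfolding absv_prod_mset[symmetric] prod_mset.distrib
    by (simp add: size_proots F.P_nonzero)
  finally show ?thesis
    by (simp add: Res_eq_prod_proots absv_mult)
qed

lemma absv_Res_le:
  assumes x: "x \<in> D"
    and nondeg: "degree P = 0 \<Longrightarrow> degree Q = 0 \<Longrightarrow> absv c = 1 \<or> absv d = 1"
  shows "absv Res \<le> max (absv (ps_eval F x)) (absv (ps_eval G x))"
proof -
  obtain z where z: "enumerates_roots D F (degree P) z"
    using F.ex_enumerates_roots by blast
  obtain w where w: "enumerates_roots D G (degree Q) w"
    using G.ex_enumerates_roots by blast
  have zD: "z i \<in> D" if "i \<in> {1..degree P}" for i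
    using z that by (auto simp: enumerates_roots_def ps_roots_def)
  have wD: "w j \<in> D" if "j \<in> {1..degree Q}" for j
    using w that by (auto simp: enumerates_roots_def ps_roots_def)
  have le_1: "absv (x - y) \<le> 1" if "y \<in> D" for y
    using absv_diff[of x y] F.D_le_1[OF x] F.D_le_1[OF that] by linarith
  have tri: "absv (z i - w j) \<le> max (absv (x - z i)) (absv (x - w j))" for i j
    using absv_diff[of "x - w j" "x - z i"] by (simp add: max.commute)
  have "absv c ^ card {1..degree Q} * absv d ^ card {1..degree P} *
      (\<Prod>i=1..degree P. \<Prod>j=1..degree Q. absv (z i - w j))
    \<le> max (absv c * (\<Prod>i=1..degree P. absv (x - z i))) (absv d * (\<Prod>j=1..degree Q. absv (x - w j)))"
    using nondeg F.c_le_1 G.c_le_1 tri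
    by (intro resultant_bound) (auto intro!: le_1 zD wD)
  moreover have "absv Res = absv c ^ degree Q * absv d ^ degree P *
      (\<Prod>i=1..degree P. \<Prod>j=1..degree Q. absv (z i - w j))"
    by (simp add: Res_eq_prod[OF z w refl refl] absv_mult absv_power absv_prod)
  moreover have "absv (ps_eval F x) = absv c * (\<Prod>i=1..degree P. absv (x - z i))"
    unfolding F.absv_ps_eval_eq_prod[OF x] z[unfolded F.enumerates_roots_iff, symmetric]
    by (simp add: prod_unfold_prod_mset multiset.map_comp comp_def)
  moreover have "absv (ps_eval G x) = absv d * (\<Prod>j=1..degree Q. absv (x - w j))"
    unfolding G.absv_ps_eval_eq_prod[OF x] w[unfolded G.enumerates_roots_iff, symmetric]
    by (simp add: prod_unfold_prod_mset multiset.map_comp comp_def)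
  ultimately show ?thesis
    by simp
qed

end

theorem proposition2p1:
  fixes p :: nat and v :: "'a::{field_char_0, complete_space} \<Rightarrow> ereal"
    and F G :: "'a fps" and P Q :: "'a poly"
    and D :: "'a set" and n N :: nat and R :: 'a
  assumes "Cp p v"
    and "integral_fps v F" and "integral_fps v G"
    and "converges_on D F" and "converges_on D G"
    and "(D = open_disc v \<and>
          wideg_finite v F \<and> wideg_finite v G \<and> n = wideg v F \<and> N = wideg v G \<and>
          distinguished_open v F P \<and> distinguished_open v G Q \<and>
          R = Res_open v F G) \<or>
         (D = closed_disc v \<and>
          Lwideg_finite v F \<and> Lwideg_finite v G \<and> n = Lwideg v F \<and> N = Lwideg v G \<and>
          distinguished_closed v F P \<and> distinguished_closed v G Q \<and>
          R = Res_closed v F G)"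
  shows "let A = Polynomial.smult (fps_nth F n) P; B = Polynomial.smult (fps_nth G N) Q in
      v R = v (resultant A B) \<and>
      (\<exists>z. enumerates_roots D F n z) \<and> (\<exists>w. enumerates_roots D G N w) \<and>
      (\<forall>z w. enumerates_roots D F n z \<longrightarrow> enumerates_roots D G N w \<longrightarrow>
         resultant A B =
           fps_nth F n ^ N * fps_nth G N ^ n * (\<Prod>i=1..n. \<Prod>j=1..N. z i - w j)) \<and>
      resultant A B = det (sylvester_mat A B) \<and>
      (\<not> (n = 0 \<and> N = 0 \<and> 0 < v (fps_nth F 0) \<and> 0 < v (fps_nth G 0)) \<longrightarrow>
         (SUP x\<in>D. min (v (ps_eval F x)) (v (ps_eval G x))) \<le> v (resultant A B))"
proof -
  interpret Cp p v by fact
  have R: "R = fps_nth F n ^ N * (\<Prod>z\<in>ps_roots D F. ps_eval G z ^ root_mult D F z)"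
    and deg: "degree P = n" "degree Q = N"
    using assms(6)
    by (auto simp: Res_open_def Res_closed_def distinguished_open_def distinguished_closed_def)
  obtain h k where "weierstrass_factorization p v D F (fps_nth F n) P h"
    and "weierstrass_factorization p v D G (fps_nth G N) Q k"
    using assms(2,3,6) weierstrass_factorization_open weierstrass_factorization_closed by metis
  then interpret two_weierstrass_factorizations p v D F "fps_nth F n" P h G "fps_nth G N" Q k
    using Cp_axioms by (simp add: two_weierstrass_factorizations_def)
  have "v R = v Res"
    using absv_Res_eq unfolding R deg by (simp add: absv_eq_iff)
  moreover have "(SUP x\<in>D. min (v (ps_eval F x)) (v (ps_eval G x))) \<le> v Res"
    if nondeg: "\<not> (n = 0 \<and> N = 0 \<and> 0 < v (fps_nth F 0) \<and> 0 < v (fps_nth G 0))"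
  proof (rule SUP_least)
    fix x assume x: "x \<in> D"
    have "absv (fps_nth F n) = 1 \<or> absv (fps_nth G N) = 1" if "degree P = 0" "degree Q = 0"
      using nondeg that F.c_le_1 G.c_le_1 by (auto simp: deg simp flip: absv_less_1_iff)
    from absv_Res_le[OF x this] show "min (v (ps_eval F x)) (v (ps_eval G x)) \<le> v Res"
      by (simp add: le_max_iff_disj min_le_iff_disj absv_le_iff)
  qed
  ultimately show ?thesis
    using F.ex_enumerates_roots G.ex_enumerates_roots Res_eq_prod
    unfolding Let_def deg by (auto simp: resultant_def)
qed

end
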